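(* Let $T=T(t_n,d_n)$ and put $c_n=\frac{d_{n+1}}{t_n}-d_nt_n$ for $n\in\mathbb{Z}$. Suppose that there exist a bijective mapping $g:\mathbb{Z}\to\mathbb{Z}$ and $N\in\mathbb{Z}$ such that the sets of singular values of $A_n$, for $n>N$, are distinct from each other, and such that $\operatorname{trace}A_n=\operatorname{trace}A_{g(n)}$ for all $n\in\mathbb{Z}$. If one of the following two conditions is true (for all $n\in\mathbb{Z}$): (1) $\frac{\overline{t_n}}{t_{n-1}}\,c_n\,\overline{c_{n-1}}\notin\mathbb{R}$; (2) $t_n\overline{c_n}\left(|t_{n-1}|^2-\frac{1}{|t_{n-1}|^2}+|c_{n-1}|^2\right)\neq\frac{1}{t_{n-1}}\overline{c_{n-1}}\left(|t_n|^2-\frac{1}{|t_n|^2}-|c_n|^2\right)$; then $T$ is irreducible.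
   Context: Let $\{e_n\}_{n\in\mathbb{Z}}$ be the standard orthonormal basis of $l^2(\mathbb{Z})$ (complex scalars). For a sequence $\{t_n\}_{n\in\mathbb{Z}}$ of non-zero complex numbers, let $T_0,T_1$ be the bounded bilateral weighted shifts on $l^2(\mathbb{Z})$ given by $T_0e_n=t_ne_{n+1}$ and $T_1e_n=\frac{1}{t_n}e_{n+1}$. Let $\{d_n\}_{n\in\mathbb{Z}}$ be a uniformly bounded sequence of complex numbers and $X$ the diagonal operator $Xe_n=d_ne_n$; it is assumed that $XT_1\neq T_0X$. Define $$T(t_n,d_n)=\begin{pmatrix}T_0&XT_1-T_0X\\0&T_1\end{pmatrix}$$ acting on $l^2(\mathbb{Z})\oplus l^2(\mathbb{Z})$. Let $H(n)=\operatorname{span}\{(e_n,0),(0,e_n)\}$, $T_n=T|_{H(n)}:H(n)\to H(n+1)$ and $A_n=T_n^*T_n:H(n)\to H(n)$. A bounded operator is irreducible if its only reducing subspaces (closed subspaces $\mathcal{M}$ such that $\mathcal{M}$ and $\mathcal{M}^\perp$ are both invariant) are $\{0\}$ and the whole space. *)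

theory Defs
  imports "HOL-Analysis.Analysis"
begin

section \<open>Complex inner product spaces\<close>

text \<open>
  The library only knows real inner product spaces. The class below adds a complex scalar
  multiplication and a complex inner product (linear in the first argument) that are compatible
  with the given real structure, so that the topology is that of the norm
  \<open>sqrt (cinner x x)\<close>.
\<close>

class complex_inner = real_inner +
  fixes scaleC :: "complex \<Rightarrow> 'a \<Rightarrow> 'a"  (infixr \<open>*\<^sub>C\<close> 75)
    and cinner :: "'a \<Rightarrow> 'a \<Rightarrow> complex"
  assumes scaleC_add_right: "a *\<^sub>C (x + y) = a *\<^sub>C x + a *\<^sub>C y"
    and scaleC_add_left: "(a + b) *\<^sub>C x = a *\<^sub>C x + b *\<^sub>C x"
    and scaleC_scaleC: "a *\<^sub>C b *\<^sub>C x = (a * b) *\<^sub>C x"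
    and scaleR_scaleC: "scaleR r x = complex_of_real r *\<^sub>C x"
    and cinner_commute: "cinner x y = cnj (cinner y x)"
    and cinner_add_left: "cinner (x + y) z = cinner x z + cinner y z"
    and cinner_scaleC_left: "cinner (a *\<^sub>C x) y = a * cinner x y"
    and inner_cinner: "inner x y = Re (cinner x y)"

global_interpretation complex_vector: vector_space "scaleC :: complex \<Rightarrow> 'a \<Rightarrow> 'a::complex_inner"
  defines csubspace = complex_vector.subspace
    and cspan = complex_vector.span
    and cdependent = complex_vector.dependent
    and crepresentation = complex_vector.representation
proof unfold_locales
  show "1 *\<^sub>C x = x" for x :: 'a
    using scaleR_scaleC[of 1 x] by simp
qed (simp_all add: scaleC_add_right scaleC_add_left scaleC_scaleC)

instantiation prod :: (complex_inner, complex_inner) complex_inner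
begin

definition scaleC_prod_def: "scaleC a z = (scaleC a (fst z), scaleC a (snd z))"

definition cinner_prod_def: "cinner z w = cinner (fst z) (fst w) + cinner (snd z) (snd w)"

instance
proof
  fix a b :: complex and r :: real and x y z :: "'a \<times> 'b"
  show "a *\<^sub>C (x + y) = a *\<^sub>C x + a *\<^sub>C y" "(a + b) *\<^sub>C x = a *\<^sub>C x + b *\<^sub>C x"
    "a *\<^sub>C b *\<^sub>C x = (a * b) *\<^sub>C x"
    by (simp_all add: scaleC_prod_def scaleC_add_right scaleC_add_left scaleC_scaleC)
  show "scaleR r x = complex_of_real r *\<^sub>C x"
    unfolding scaleC_prod_def scaleR_prod_def
    by (rule arg_cong2[where f = Pair]) (rule scaleR_scaleC)+
  show "cinner x y = cnj (cinner y x)"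
    unfolding cinner_prod_def complex_cnj_add by (rule arg_cong2[where f = plus]) (rule cinner_commute)+
  show "cinner (x + y) z = cinner x z + cinner y z"
    by (simp add: cinner_prod_def cinner_add_left)
  show "cinner (a *\<^sub>C x) y = a * cinner x y"
    by (simp add: cinner_prod_def scaleC_prod_def cinner_scaleC_left distrib_left)
  show "inner x y = Re (cinner x y)"
    by (simp only: cinner_prod_def inner_prod_def inner_cinner plus_complex.sel)
qed

end

section \<open>The Hilbert space of square-summable families\<close>

typedef 'i ell2 = "{x :: 'i \<Rightarrow> complex. (\<lambda>i. (cmod (x i))\<^sup>2) summable_on UNIV}"
  morphisms ell2_coord Abs_ell2
  by (rule exI[of _ "\<lambda>_. 0"]) simp

setup_lifting type_definition_ell2

lemma square_summable_mult:
  fixes x y :: "'i \<Rightarrow> complex"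
  assumes "(\<lambda>i. (cmod (x i))\<^sup>2) summable_on UNIV" "(\<lambda>i. (cmod (y i))\<^sup>2) summable_on UNIV"
  shows "(\<lambda>i. x i * cnj (y i)) summable_on UNIV"
proof -
  have "(\<lambda>i. norm (x i * cnj (y i))) summable_on UNIV"
  proof (rule summable_on_comparison_test)
    show "(\<lambda>i. (cmod (x i))\<^sup>2 + (cmod (y i))\<^sup>2) summable_on UNIV"
      using assms by (rule summable_on_add)
  next
    fix i
    have "cmod (x i * cnj (y i)) = cmod (x i) * cmod (y i)"
      by (simp only: norm_mult complex_mod_cnj)
    moreover have "0 \<le> cmod (x i) * cmod (y i)"
      by (intro mult_nonneg_nonneg norm_ge_zero)
    ultimately show "cmod (x i * cnj (y i)) \<le> (cmod (x i))\<^sup>2 + (cmod (y i))\<^sup>2"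
      using sum_squares_bound[of "cmod (x i)" "cmod (y i)"] by linarith
  qed (rule norm_ge_zero)
  then show ?thesis
    by (rule Infinite_Sum.abs_summable_summable)
qed

lemma square_summable_add:
  fixes x y :: "'i \<Rightarrow> complex"
  assumes "(\<lambda>i. (cmod (x i))\<^sup>2) summable_on UNIV" "(\<lambda>i. (cmod (y i))\<^sup>2) summable_on UNIV"
  shows "(\<lambda>i. (cmod (x i + y i))\<^sup>2) summable_on UNIV"
proof (rule summable_on_comparison_test)
  show "(\<lambda>i. 2 * (cmod (x i))\<^sup>2 + 2 * (cmod (y i))\<^sup>2) summable_on UNIV"
    using assms by (intro summable_on_add summable_on_cmult_right)
next
  fix i
  have "(cmod (x i + y i))\<^sup>2 \<le> (cmod (x i) + cmod (y i))\<^sup>2"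
    by (intro power_mono norm_triangle_ineq) auto
  also have "\<dots> \<le> 2 * (cmod (x i))\<^sup>2 + 2 * (cmod (y i))\<^sup>2"
    using sum_squares_bound[of "cmod (x i)" "cmod (y i)"] by (simp add: power2_sum)
  finally show "(cmod (x i + y i))\<^sup>2 \<le> 2 * (cmod (x i))\<^sup>2 + 2 * (cmod (y i))\<^sup>2" .
qed auto

lemma square_summable_scale:
  fixes x :: "'i \<Rightarrow> complex"
  assumes "(\<lambda>i. (cmod (x i))\<^sup>2) summable_on UNIV"
  shows "(\<lambda>i. (cmod (a * x i))\<^sup>2) summable_on UNIV"
  using assms by (simp add: norm_mult power_mult_distrib summable_on_cmult_right)

instantiation ell2 :: (type) complex_inner
begin

lift_definition zero_ell2 :: "'a ell2" is "\<lambda>_. 0" by simp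

lift_definition plus_ell2 :: "'a ell2 \<Rightarrow> 'a ell2 \<Rightarrow> 'a ell2" is "\<lambda>x y i. x i + y i"
  by (rule square_summable_add)

lift_definition uminus_ell2 :: "'a ell2 \<Rightarrow> 'a ell2" is "\<lambda>x i. - x i" by simp

lift_definition minus_ell2 :: "'a ell2 \<Rightarrow> 'a ell2 \<Rightarrow> 'a ell2" is "\<lambda>x y i. x i - y i"
  using square_summable_add[where y = "\<lambda>i. - y i" for y] by simp

lift_definition scaleC_ell2 :: "complex \<Rightarrow> 'a ell2 \<Rightarrow> 'a ell2" is "\<lambda>a x i. a * x i"
  by (rule square_summable_scale)

definition scaleR_ell2 :: "real \<Rightarrow> 'a ell2 \<Rightarrow> 'a ell2"
  where "scaleR_ell2 r x = complex_of_real r *\<^sub>C x"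

lift_definition cinner_ell2 :: "'a ell2 \<Rightarrow> 'a ell2 \<Rightarrow> complex"
  is "\<lambda>x y. \<Sum>\<^sub>\<infinity>i. x i * cnj (y i)" .

definition inner_ell2 :: "'a ell2 \<Rightarrow> 'a ell2 \<Rightarrow> real"
  where "inner_ell2 x y = Re (cinner x y)"

definition norm_ell2 :: "'a ell2 \<Rightarrow> real"
  where "norm_ell2 x = sqrt (inner x x)"

definition dist_ell2 :: "'a ell2 \<Rightarrow> 'a ell2 \<Rightarrow> real"
  where "dist_ell2 x y = norm (x - y)"

definition sgn_ell2 :: "'a ell2 \<Rightarrow> 'a ell2"
  where "sgn_ell2 x = scaleR (inverse (norm x)) x"

definition uniformity_ell2 :: "('a ell2 \<times> 'a ell2) filter"
  where "uniformity_ell2 = (INF e\<in>{0<..}. principal {(x, y). dist x y < e})"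

definition open_ell2 :: "'a ell2 set \<Rightarrow> bool"
  where "open_ell2 U \<longleftrightarrow> (\<forall>x\<in>U. \<forall>\<^sub>F (x', y) in uniformity. x' = x \<longrightarrow> y \<in> U)"

instance
proof
  have scaleC_add_right: "a *\<^sub>C (x + y) = a *\<^sub>C x + a *\<^sub>C y" for a and x y :: "'a ell2"
    by transfer (simp add: algebra_simps)
  have scaleC_add_left: "(a + b) *\<^sub>C x = a *\<^sub>C x + b *\<^sub>C x" for a b and x :: "'a ell2"
    by transfer (simp add: algebra_simps)
  have scaleC_scaleC: "a *\<^sub>C b *\<^sub>C x = (a * b) *\<^sub>C x" for a b and x :: "'a ell2"
    by transfer (simp add: algebra_simps)
  have scaleC_one: "1 *\<^sub>C x = x" for x :: "'a ell2"
    by transfer simp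
  have cinner_commute: "cinner x y = cnj (cinner y x)" for x y :: "'a ell2"
    by transfer (simp add: mult.commute flip: infsum_cnj)
  have cinner_add_left: "cinner (x + y) z = cinner x z + cinner y z" for x y z :: "'a ell2"
    by transfer (simp add: distrib_right infsum_add square_summable_mult)
  have cinner_scaleC_left: "cinner (a *\<^sub>C x) y = a * cinner x y" for a and x y :: "'a ell2"
    by transfer (simp add: mult.assoc infsum_cmult_right')
  have cinner_self: "cinner x x = complex_of_real (\<Sum>\<^sub>\<infinity>i. (cmod (ell2_coord x i))\<^sup>2)"
    for x :: "'a ell2"
  proof -
    have "(\<lambda>i. (cmod (ell2_coord x i))\<^sup>2) summable_on UNIV"
      using ell2_coord[of x] by simp
    then have "((\<lambda>i. complex_of_real ((cmod (ell2_coord x i))\<^sup>2)) has_sum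
        complex_of_real (\<Sum>\<^sub>\<infinity>i. (cmod (ell2_coord x i))\<^sup>2)) UNIV"
      by (intro has_sum_of_real has_sum_infsum)
    then show ?thesis
      unfolding cinner_ell2.rep_eq complex_norm_square by (rule infsumI)
  qed
  fix a b :: complex and r s :: real and x y z :: "'a ell2" and U :: "'a ell2 set"
  show "x + y + z = x + (y + z)" "x + y = y + x" "0 + x = x" "- x + x = 0" "x - y = x + - y"
    by (transfer, simp add: algebra_simps)+
  show "scaleR r (x + y) = scaleR r x + scaleR r y"
    "scaleR (r + s) x = scaleR r x + scaleR s x"
    "scaleR r (scaleR s x) = scaleR (r * s) x" "scaleR 1 x = x"
    by (simp_all add: scaleR_ell2_def scaleC_add_right scaleC_add_left scaleC_scaleC scaleC_one)
  show "a *\<^sub>C (x + y) = a *\<^sub>C x + a *\<^sub>C y"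
    by (rule scaleC_add_right)
  show "(a + b) *\<^sub>C x = a *\<^sub>C x + b *\<^sub>C x"
    by (rule scaleC_add_left)
  show "a *\<^sub>C b *\<^sub>C x = (a * b) *\<^sub>C x"
    by (rule scaleC_scaleC)
  show "scaleR r x = complex_of_real r *\<^sub>C x"
    by (rule scaleR_ell2_def)
  show "cinner x y = cnj (cinner y x)"
    by (rule cinner_commute)
  show "cinner (x + y) z = cinner x z + cinner y z"
    by (rule cinner_add_left)
  show "cinner (a *\<^sub>C x) y = a * cinner x y"
    by (rule cinner_scaleC_left)
  show "inner x y = Re (cinner x y)"
    by (rule inner_ell2_def)
  show "inner x y = inner y x"
    unfolding inner_ell2_def by (subst cinner_commute) simp
  show "inner (x + y) z = inner x z + inner y z" "inner (scaleR r x) y = r * inner x y"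
    by (simp_all add: inner_ell2_def cinner_add_left scaleR_ell2_def cinner_scaleC_left)
  show "0 \<le> inner x x"
    by (simp add: inner_ell2_def cinner_self infsum_nonneg)
  show "inner x x = 0 \<longleftrightarrow> x = 0"
  proof
    assume "inner x x = 0"
    then have 0: "(\<Sum>\<^sub>\<infinity>i. (cmod (ell2_coord x i))\<^sup>2) = 0"
      by (simp add: inner_ell2_def cinner_self)
    have "(\<lambda>i. (cmod (ell2_coord x i))\<^sup>2) summable_on UNIV"
      using ell2_coord[of x] by simp
    then have "(cmod (ell2_coord x i))\<^sup>2 = 0" for i
      using 0 by (intro nonneg_infsum_le_0D[where A = UNIV]) auto
    then have "ell2_coord x = ell2_coord 0"
      by (simp add: zero_ell2.rep_eq fun_eq_iff)
    then show "x = 0"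
      by (simp add: ell2_coord_inject)
  next
    assume "x = 0"
    then show "inner x x = 0"
      by (simp add: inner_ell2_def cinner_self zero_ell2.rep_eq)
  qed
  show "norm x = sqrt (inner x x)"
    by (rule norm_ell2_def)
  show "dist x y = norm (x - y)"
    by (rule dist_ell2_def)
  show "sgn x = scaleR (inverse (norm x)) x"
    by (rule sgn_ell2_def)
  show "(uniformity :: ('a ell2 \<times> 'a ell2) filter) =
      (INF e\<in>{0<..}. principal {(x, y). dist x y < e})"
    by (rule uniformity_ell2_def)
  show "open U \<longleftrightarrow> (\<forall>x\<in>U. \<forall>\<^sub>F (x', y) in uniformity. x' = x \<longrightarrow> y \<in> U)"
    by (rule open_ell2_def)
qed

end

lift_definition ell2_basis :: "'i \<Rightarrow> 'i ell2" is "\<lambda>n i. if i = n then 1 else 0"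
proof -
  fix n :: 'i
  have "(\<lambda>i. (cmod (if i = n then 1 else 0))\<^sup>2) summable_on {n}"
    by (rule summable_on_finite) simp
  then show "(\<lambda>i. (cmod (if i = n then 1 else 0))\<^sup>2) summable_on UNIV"
    by (rule summable_on_cong_neutral[THEN iffD1, rotated -1]) auto
qed

section \<open>Operators\<close>

definition bounded_clinear :: "('a::complex_inner \<Rightarrow> 'b::complex_inner) \<Rightarrow> bool"
  where "bounded_clinear F \<longleftrightarrow> bounded_linear F \<and> (\<forall>a x. F (a *\<^sub>C x) = a *\<^sub>C F x)"

definition orthogonal_complement :: "'a::complex_inner set \<Rightarrow> 'a set"
  where "orthogonal_complement M = {y. \<forall>x\<in>M. cinner x y = 0}"

definition reducing_subspace :: "('a::complex_inner \<Rightarrow> 'a) \<Rightarrow> 'a set \<Rightarrow> bool"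
  where "reducing_subspace F M \<longleftrightarrow> csubspace M \<and> closed M \<and> F ` M \<subseteq> M \<and>
    F ` orthogonal_complement M \<subseteq> orthogonal_complement M"

definition irreducible_operator :: "('a::complex_inner \<Rightarrow> 'a) \<Rightarrow> bool"
  where "irreducible_operator F \<longleftrightarrow> (\<forall>M. reducing_subspace F M \<longrightarrow> M = {0} \<or> M = UNIV)"

text \<open>
  Linear maps between finite-dimensional subspaces \<open>V\<close>, \<open>W\<close> are represented by functions that
  are only meaningful on \<open>V\<close> (extensional, as in \<open>HOL-Library.FuncSet\<close>). The adjoint
  \<open>F\<^sup>* : W \<rightarrow> V\<close> is taken relative to the subspaces, not to the ambient space.
\<close>

definition adjoint_on ::
    "'a::complex_inner set \<Rightarrow> 'b::complex_inner set \<Rightarrow> ('a \<Rightarrow> 'b) \<Rightarrow> 'b \<Rightarrow> 'a"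
  where "adjoint_on V W F = (\<lambda>w\<in>W. THE u. u \<in> V \<and> (\<forall>v\<in>V. cinner (F v) w = cinner v u))"

text \<open>The singular values of \<open>F : V \<rightarrow> V\<close> are the square roots of the eigenvalues of \<open>F\<^sup>* F\<close>.\<close>

definition singular_values :: "'a::complex_inner set \<Rightarrow> ('a \<Rightarrow> 'a) \<Rightarrow> real set"
  where "singular_values V F =
    {s. 0 \<le> s \<and> (\<exists>v\<in>V. v \<noteq> 0 \<and> adjoint_on V V F (F v) = complex_of_real (s\<^sup>2) *\<^sub>C v)}"

text \<open>
  Trace of the matrix, with respect to the finite basis \<open>B\<close>, of a linear map on \<open>cspan B\<close>.
\<close>

definition trace_wrt :: "'a::complex_inner set \<Rightarrow> ('a \<Rightarrow> 'a) \<Rightarrow> complex"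
  where "trace_wrt B F = (\<Sum>b\<in>B. crepresentation B (F b) b)"

section \<open>Bilateral shifts and the operator \<open>T(t\<^sub>n, d\<^sub>n)\<close>\<close>

text \<open>
  A bounded operator is determined by its values on the orthonormal basis, so each of the next two
  predicates describes at most one operator; it exists precisely if the weights are bounded.
\<close>

definition is_weighted_shift :: "(int \<Rightarrow> complex) \<Rightarrow> (int ell2 \<Rightarrow> int ell2) \<Rightarrow> bool"
  where "is_weighted_shift w S \<longleftrightarrow>
    bounded_clinear S \<and> (\<forall>n. S (ell2_basis n) = w n *\<^sub>C ell2_basis (n + 1))"

definition is_diagonal :: "(int \<Rightarrow> complex) \<Rightarrow> (int ell2 \<Rightarrow> int ell2) \<Rightarrow> bool"
  where "is_diagonal w D \<longleftrightarrow>
    bounded_clinear D \<and> (\<forall>n. D (ell2_basis n) = w n *\<^sub>C ell2_basis n)"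

definition block_operator ::
    "(int ell2 \<Rightarrow> int ell2) \<Rightarrow> (int ell2 \<Rightarrow> int ell2) \<Rightarrow> (int ell2 \<Rightarrow> int ell2) \<Rightarrow>
      int ell2 \<times> int ell2 \<Rightarrow> int ell2 \<times> int ell2"
  where "block_operator T0 T1 X = (\<lambda>(x, y). (T0 x + (X (T1 y) - T0 (X y)), T1 y))"

definition H_basis :: "int \<Rightarrow> (int ell2 \<times> int ell2) set"
  where "H_basis n = {(ell2_basis n, 0), (0, ell2_basis n)}"

definition H_space :: "int \<Rightarrow> (int ell2 \<times> int ell2) set"
  where "H_space n = cspan (H_basis n)"

definition T_restr ::
    "(int ell2 \<times> int ell2 \<Rightarrow> int ell2 \<times> int ell2) \<Rightarrow> int \<Rightarrow> int ell2 \<times> int ell2 \<Rightarrow> int ell2 \<times> int ell2"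
  where "T_restr T n = restrict T (H_space n)"

definition A_op ::
    "(int ell2 \<times> int ell2 \<Rightarrow> int ell2 \<times> int ell2) \<Rightarrow> int \<Rightarrow> int ell2 \<times> int ell2 \<Rightarrow> int ell2 \<times> int ell2"
  where "A_op T n = compose (H_space n) (adjoint_on (H_space n) (H_space (n + 1)) (T_restr T n)) (T_restr T n)"

end

theory Submission
  imports Defs
begin

text \<open>
  In the decomposition of \<open>l\<^sup>2(\<int>) \<oplus> l\<^sup>2(\<int>)\<close> into the spaces \<open>H(n)\<close>, the operator \<open>T\<close> is a bilateral shift
  whose weights are the matrices \<open>W\<^sub>n\<close> with rows \<open>(t\<^sub>n, c\<^sub>n)\<close> and \<open>(0, 1/t\<^sub>n)\<close>, all of determinant 1. Let \<open>P\<close> be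
  the orthogonal projection onto a reducing subspace, and let \<open>Q\<^sub>m\<^sub>n\<close> be its 2x2 blocks. As \<open>P\<close> commutes with
  \<open>T\<close> and is selfadjoint, \<open>Q\<^sub>m\<^sub>+\<^sub>1\<^sub>,\<^sub>n\<^sub>+\<^sub>1 W\<^sub>n = W\<^sub>m Q\<^sub>m\<^sub>n\<close>, and \<open>Q\<^sub>m\<^sub>n\<close> intertwines \<open>A\<^sub>n = W\<^sub>n\<^sup>*W\<^sub>n\<close> with \<open>A\<^sub>m\<close>, and
  likewise for the matrices \<open>W\<^sub>n\<^sub>-\<^sub>1W\<^sub>n\<^sub>-\<^sub>1\<^sup>*\<close>.

  Since \<open>det A\<^sub>n = 1\<close>, the trace of \<open>A\<^sub>n\<close> determines its singular values (\<open>singular_values_A_op\<close>), so that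
  the traces differ far to the right. Matrices with equal nonzero determinants and different traces have
  no nonzero intertwiner (\<open>intertwiner_eq_0\<close>); hence the off-diagonal blocks far to the right are zero, and
  those further left vanish too because the weights are invertible.

  The diagonal blocks commute with both \<open>W\<^sub>n\<^sup>*W\<^sub>n\<close> and \<open>W\<^sub>n\<^sub>-\<^sub>1W\<^sub>n\<^sub>-\<^sub>1\<^sup>*\<close>. Either of the two conditions
  makes these two matrices fail to commute (\<open>block_weight_commute\<close>), which leaves only scalar matrices
  (\<open>commutant_scalar\<close>). The scalar does not depend on \<open>n\<close>, so \<open>P\<close> is a multiple of the identity, and being
  idempotent it is 0 or the identity.

  The projection \<open>P\<close> exists because \<open>l\<^sup>2\<close> is complete.
\<close>

section \<open>Orthogonal projections in complex Hilbert spaces\<close>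

lemma cinner_add_right: "cinner x (y + z) = cinner x y + cinner x z"
  by (subst (1 2 3) cinner_commute) (simp add: cinner_add_left)

lemma cinner_scaleC_right: "cinner x (a *\<^sub>C y) = cnj a * cinner x y"
  by (subst (1 2) cinner_commute) (simp add: cinner_scaleC_left)

lemma cinner_zero_left [simp]: "cinner 0 y = 0"
  using cinner_add_left[of 0 0 y] by simp

lemma cinner_zero_right [simp]: "cinner x 0 = 0"
  using cinner_add_right[of x 0 0] by simp

lemma cinner_diff_left: "cinner (x - y) z = cinner x z - cinner y z"
  using cinner_add_left[of "x - y" y z] by simp

lemma cinner_eq_Complex: "cinner x y = Complex (inner x y) (inner x (\<i> *\<^sub>C y))"
  by (simp add: complex_eq_iff inner_cinner cinner_scaleC_right)

lemma cinner_self_eq_0_iff: "cinner x x = 0 \<longleftrightarrow> x = 0"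
  by (metis cinner_zero_left inner_cinner inner_eq_zero_iff zero_complex.sel(1))

lemma continuous_on_cinner_left: "continuous_on S F \<Longrightarrow> continuous_on S (\<lambda>x. cinner (F x) y)"
  unfolding cinner_eq_Complex Complex_eq by (intro continuous_intros)

lemma csubspace_orthogonal_complement: "csubspace (orthogonal_complement M)"
  unfolding complex_vector.subspace_def orthogonal_complement_def
  by (auto simp: cinner_add_right cinner_scaleC_right)

lemma inter_orthogonal_complement:
  assumes "x \<in> M" "x \<in> orthogonal_complement M"
  shows "x = 0"
  using assms by (auto simp: orthogonal_complement_def cinner_self_eq_0_iff)

text \<open>
  A minimizing sequence for the distance from \<open>x\<close> to \<open>M\<close> is a Cauchy sequence by the parallelogram
  law. Its limit is a nearest point, and moving it within \<open>M\<close> cannot decrease the distance, which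
  forces orthogonality.
\<close>
lemma orthogonal_decomposition:
  fixes M :: "'a::{complex_inner,complete_space} set"
  assumes M: "csubspace M" "closed M"
  obtains y where "y \<in> M" "x - y \<in> orthogonal_complement M"
proof -
  have ne: "M \<noteq> {}"
    using complex_vector.subspace_0[OF M(1)] by blast
  have scaleR_M: "r *\<^sub>R z \<in> M" if "z \<in> M" for r z
    unfolding scaleR_scaleC using that M(1) by (rule complex_vector.subspace_scale[rotated])
  define \<delta> where "\<delta> = infdist x M"
  have \<delta>: "0 \<le> \<delta>" "\<And>z. z \<in> M \<Longrightarrow> \<delta> \<le> norm (x - z)"
    unfolding \<delta>_def by (auto simp: infdist_nonneg dist_norm[symmetric] infdist_le)
  have "\<exists>y\<in>M. (norm (x - y))\<^sup>2 < \<delta>\<^sup>2 + inverse (real (Suc n))" for n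
  proof -
    have "\<delta> < sqrt (\<delta>\<^sup>2 + inverse (real (Suc n)))"
      using \<delta>(1) by (intro real_less_rsqrt) simp
    then have "(INF z\<in>M. dist x z) < sqrt (\<delta>\<^sup>2 + inverse (real (Suc n)))"
      using ne by (simp add: \<delta>_def infdist_def)
    then obtain y where y: "y \<in> M" "dist x y < sqrt (\<delta>\<^sup>2 + inverse (real (Suc n)))"
      using ne by (subst (asm) cINF_less_iff) auto
    have "(dist x y)\<^sup>2 < (sqrt (\<delta>\<^sup>2 + inverse (real (Suc n))))\<^sup>2"
      by (rule power_strict_mono[OF y(2)]) auto
    then show ?thesis
      using y(1) by (auto simp: dist_norm)
  qed
  then obtain Y where Y: "\<And>n. Y n \<in> M" "\<And>n. (norm (x - Y n))\<^sup>2 < \<delta>\<^sup>2 + inverse (real (Suc n))"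
    by metis
  have close: "(norm (Y m - Y n))\<^sup>2 < 2 * inverse (real (Suc m)) + 2 * inverse (real (Suc n))" for m n
  proof -
    have "(1 / 2) *\<^sub>R (Y m + Y n) \<in> M"
      by (intro scaleR_M complex_vector.subspace_add[OF M(1)] Y)
    then have "\<delta> \<le> norm (x - (1 / 2) *\<^sub>R (Y m + Y n))"
      by (rule \<delta>)
    then have mid: "\<delta>\<^sup>2 \<le> (norm (x - (1 / 2) *\<^sub>R (Y m + Y n)))\<^sup>2"
      using \<delta>(1) by (rule power_mono)
    have "(norm (Y m - Y n))\<^sup>2 =
        2 * (norm (x - Y m))\<^sup>2 + 2 * (norm (x - Y n))\<^sup>2 - 4 * (norm (x - (1 / 2) *\<^sub>R (Y m + Y n)))\<^sup>2"
      by (simp add: power2_norm_eq_inner inner_diff inner_add inner_commute algebra_simps)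
    with mid Y(2)[of m] Y(2)[of n] show ?thesis
      by linarith
  qed
  have "Cauchy Y"
  proof (rule CauchyI)
    fix e :: real
    assume "0 < e"
    then have "0 < e\<^sup>2 / 4"
      by simp
    then obtain K where K: "inverse (real (Suc K)) < e\<^sup>2 / 4"
      using reals_Archimedean by blast
    have "norm (Y m - Y n) < e" if "m \<ge> K" "n \<ge> K" for m n
    proof -
      have "inverse (real (Suc m)) \<le> inverse (real (Suc K))"
        "inverse (real (Suc n)) \<le> inverse (real (Suc K))"
        using that by (auto intro!: le_imp_inverse_le)
      with close[of m n] K have "(norm (Y m - Y n))\<^sup>2 < e\<^sup>2"
        by linarith
      then show ?thesis
        by (rule power2_less_imp_less) (use \<open>0 < e\<close> in simp)
    qed
    then show "\<exists>K. \<forall>m\<ge>K. \<forall>n\<ge>K. norm (Y m - Y n) < e"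
      by blast
  qed
  then obtain y where lim: "Y \<longlonglongrightarrow> y"
    using Cauchy_convergent convergent_def by blast
  have "y \<in> M"
    using closed_sequentially[OF M(2) Y(1) lim] .
  have nearest: "(norm (x - y))\<^sup>2 \<le> \<delta>\<^sup>2"
  proof (rule LIMSEQ_le)
    show "(\<lambda>n. (norm (x - Y n))\<^sup>2) \<longlonglongrightarrow> (norm (x - y))\<^sup>2"
      by (intro tendsto_intros lim)
    show "(\<lambda>n. \<delta>\<^sup>2 + inverse (real (Suc n))) \<longlonglongrightarrow> \<delta>\<^sup>2"
      using tendsto_add[OF tendsto_const LIMSEQ_inverse_real_of_nat, of "\<delta>\<^sup>2"] by simp
    show "\<exists>K. \<forall>n\<ge>K. (norm (x - Y n))\<^sup>2 \<le> \<delta>\<^sup>2 + inverse (real (Suc n))"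
      using Y(2) less_imp_le by blast
  qed
  have orth: "inner z (x - y) = 0" if "z \<in> M" for z
  proof (cases "z = 0")
    case False
    then have z: "inner z z > 0"
      by simp
    \<comment> \<open>the best step length along \<open>z\<close>\<close>
    define r where "r = inner z (x - y) / inner z z"
    have "y + r *\<^sub>R z \<in> M"
      by (intro complex_vector.subspace_add[OF M(1)] scaleR_M \<open>y \<in> M\<close> that)
    then have "\<delta>\<^sup>2 \<le> (norm (x - (y + r *\<^sub>R z)))\<^sup>2"
      using \<delta> by (intro power_mono) auto
    with nearest have "(norm (x - y))\<^sup>2 \<le> (norm ((x - y) - r *\<^sub>R z))\<^sup>2"
      unfolding diff_diff_add by (rule order_trans)
    also have "\<dots> = (norm (x - y))\<^sup>2 - 2 * r * inner z (x - y) + r\<^sup>2 * inner z z"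
      unfolding power2_norm_eq_inner
      by (simp add: inner_diff inner_commute power2_eq_square algebra_simps)
    also have "\<dots> = (norm (x - y))\<^sup>2 - (inner z (x - y))\<^sup>2 / inner z z"
      using z by (simp add: r_def power2_eq_square)
    finally have "(inner z (x - y))\<^sup>2 / inner z z \<le> 0"
      by simp
    then have "(inner z (x - y))\<^sup>2 \<le> 0"
      using z by (simp add: divide_le_0_iff)
    then show ?thesis
      by simp
  qed simp
  have "cinner z (x - y) = 0" if "z \<in> M" for z
  proof -
    have "inner (\<i> *\<^sub>C z) (x - y) = 0"
      by (intro orth complex_vector.subspace_scale[OF M(1)] that)
    with orth[OF that] show ?thesis
      by (simp add: inner_cinner cinner_scaleC_left complex_eq_iff)
  qed
  then have "x - y \<in> orthogonal_complement M"
    by (simp add: orthogonal_complement_def)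
  with \<open>y \<in> M\<close> show thesis
    by (rule that)
qed

lemma closed_csubspace_eq_UNIV:
  fixes M :: "'a::{complex_inner,complete_space} set"
  assumes M: "csubspace M" "closed M" and "orthogonal_complement M \<subseteq> {0}"
  shows "M = UNIV"
proof -
  have "x \<in> M" for x
  proof -
    obtain y where "y \<in> M" "x - y \<in> orthogonal_complement M"
      using orthogonal_decomposition[OF M] .
    then show ?thesis
      using assms(3) by auto
  qed
  then show ?thesis
    by blast
qed

definition orthogonal_projection :: "'a::complex_inner set \<Rightarrow> 'a \<Rightarrow> 'a"
  where "orthogonal_projection M x = (THE y. y \<in> M \<and> x - y \<in> orthogonal_complement M)"

lemma orthogonal_projection_eqI:
  assumes "csubspace M" "y \<in> M" "x - y \<in> orthogonal_complement M"
  shows "orthogonal_projection M x = y"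
  unfolding orthogonal_projection_def
proof (rule the_equality)
  fix z
  assume z: "z \<in> M \<and> x - z \<in> orthogonal_complement M"
  have "z - y \<in> M"
    using z assms complex_vector.subspace_diff by blast
  moreover have "z - y \<in> orthogonal_complement M"
    using complex_vector.subspace_diff[OF csubspace_orthogonal_complement assms(3) z[THEN conjunct2]]
    by simp
  ultimately show "z = y"
    using inter_orthogonal_complement by force
qed (use assms in blast)

context
  fixes M :: "'a::{complex_inner,complete_space} set"
  assumes M: "csubspace M" "closed M"
begin

lemma orthogonal_projection_mem: "orthogonal_projection M x \<in> M"
  and orthogonal_projection_diff: "x - orthogonal_projection M x \<in> orthogonal_complement M"
  using orthogonal_decomposition[OF M, of x] orthogonal_projection_eqI[OF M(1)] by metis+

lemma orthogonal_projection_idem: "x \<in> M \<Longrightarrow> orthogonal_projection M x = x"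
  by (rule orthogonal_projection_eqI[OF M(1)])
    (simp_all add: complex_vector.subspace_0[OF csubspace_orthogonal_complement])

lemma orthogonal_projection_add:
  "orthogonal_projection M (x + y) = orthogonal_projection M x + orthogonal_projection M y"
proof (rule orthogonal_projection_eqI[OF M(1)])
  show "x + y - (orthogonal_projection M x + orthogonal_projection M y) \<in> orthogonal_complement M"
    using complex_vector.subspace_add[OF csubspace_orthogonal_complement
        orthogonal_projection_diff[of x] orthogonal_projection_diff[of y]]
    by (simp add: algebra_simps)
qed (intro complex_vector.subspace_add[OF M(1)] orthogonal_projection_mem)

lemma orthogonal_projection_scaleC:
  "orthogonal_projection M (a *\<^sub>C x) = a *\<^sub>C orthogonal_projection M x"
proof (rule orthogonal_projection_eqI[OF M(1)])
  show "a *\<^sub>C x - a *\<^sub>C orthogonal_projection M x \<in> orthogonal_complement M"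
    using complex_vector.subspace_scale[OF csubspace_orthogonal_complement
        orthogonal_projection_diff[of x], of a]
    by (simp add: complex_vector.scale_right_diff_distrib)
qed (intro complex_vector.subspace_scale[OF M(1)] orthogonal_projection_mem)

lemma orthogonal_projection_selfadjoint:
  "cinner (orthogonal_projection M x) y = cinner x (orthogonal_projection M y)"
proof -
  let ?P = "orthogonal_projection M"
  have "cinner (?P x) (y - ?P y) = 0" "cinner (?P y) (x - ?P x) = 0"
    using orthogonal_projection_mem orthogonal_projection_diff
    by (auto simp: orthogonal_complement_def)
  then have "cinner (?P x) (y - ?P y) = 0" "cinner (x - ?P x) (?P y) = 0"
    using cinner_commute[of "x - ?P x"] by auto
  then show ?thesis
    using cinner_add_right[of "?P x" "y - ?P y" "?P y"] cinner_diff_left[of x "?P x" "?P y"] by simp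
qed

lemma orthogonal_projection_commute:
  assumes F: "reducing_subspace F M" "\<And>x y. F (x + y) = F x + F y"
  shows "orthogonal_projection M (F x) = F (orthogonal_projection M x)"
proof (rule orthogonal_projection_eqI[OF M(1)])
  let ?y = "orthogonal_projection M x"
  show "F ?y \<in> M"
    using F(1) orthogonal_projection_mem by (auto simp: reducing_subspace_def)
  have "F x - F ?y = F (x - ?y)"
    using F(2)[of "x - ?y" ?y] by simp
  also have "\<dots> \<in> orthogonal_complement M"
    using F(1) orthogonal_projection_diff by (auto simp: reducing_subspace_def)
  finally show "F x - F ?y \<in> orthogonal_complement M" .
qed

end

section \<open>Completeness of the space of square-summable families\<close>

lemma ell2_summable: "(\<lambda>i. (cmod (ell2_coord x i))\<^sup>2) summable_on UNIV"
  using ell2_coord[of x] by simp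

lemma norm_ell2_squared: "(norm x)\<^sup>2 = (\<Sum>\<^sub>\<infinity>i. (cmod (ell2_coord x i))\<^sup>2)"
proof -
  have "((\<lambda>i. complex_of_real ((cmod (ell2_coord x i))\<^sup>2)) has_sum
      complex_of_real (\<Sum>\<^sub>\<infinity>i. (cmod (ell2_coord x i))\<^sup>2)) UNIV"
    by (intro has_sum_of_real has_sum_infsum ell2_summable)
  then have "cinner x x = complex_of_real (\<Sum>\<^sub>\<infinity>i. (cmod (ell2_coord x i))\<^sup>2)"
    unfolding cinner_ell2.rep_eq complex_norm_square by (rule infsumI)
  then show ?thesis
    by (simp add: power2_norm_eq_inner inner_cinner)
qed

lemma ell2_finite_sum_le: "finite F \<Longrightarrow> (\<Sum>i\<in>F. (cmod (ell2_coord x i))\<^sup>2) \<le> (norm x)\<^sup>2"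
  unfolding norm_ell2_squared by (rule finite_sum_le_infsum[OF ell2_summable]) auto

lemma ell2_coord_le: "cmod (ell2_coord x i) \<le> norm x"
  by (rule power2_le_imp_le) (use ell2_finite_sum_le[of "{i}" x] in simp_all)

text \<open>
  A Cauchy sequence converges coordinatewise, and the estimate on its differences, being one on
  finite partial sums, passes to the coordinatewise limit.
\<close>
instance ell2 :: (type) complete_space
proof
  fix X :: "nat \<Rightarrow> 'a ell2"
  assume X: "Cauchy X"
  have "Cauchy (\<lambda>n. ell2_coord (X n) i)" for i
  proof (rule CauchyI)
    fix e :: real
    assume "0 < e"
    then obtain K where K: "\<forall>m\<ge>K. \<forall>n\<ge>K. norm (X m - X n) < e"
      using CauchyD[OF X] by blast
    have "norm (ell2_coord (X m) i - ell2_coord (X n) i) < e" if "m \<ge> K" "n \<ge> K" for m n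
      using ell2_coord_le[of "X m - X n" i] K that by (force simp: minus_ell2.rep_eq)
    then show "\<exists>K. \<forall>m\<ge>K. \<forall>n\<ge>K. norm (ell2_coord (X m) i - ell2_coord (X n) i) < e"
      by blast
  qed
  then have "\<forall>i. \<exists>a. (\<lambda>n. ell2_coord (X n) i) \<longlonglongrightarrow> a"
    using Cauchy_convergent convergent_def by blast
  then obtain a where a: "\<And>i. (\<lambda>n. ell2_coord (X n) i) \<longlonglongrightarrow> a i"
    by metis
  have tail: "\<exists>K. \<forall>m\<ge>K. \<forall>F. finite F \<longrightarrow> (\<Sum>i\<in>F. (cmod (ell2_coord (X m) i - a i))\<^sup>2) \<le> e\<^sup>2"
    if "0 < e" for e :: real
  proof -
    obtain K where K: "\<forall>m\<ge>K. \<forall>n\<ge>K. norm (X m - X n) < e"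
      using CauchyD[OF X \<open>0 < e\<close>] by blast
    have "(\<Sum>i\<in>F. (cmod (ell2_coord (X m) i - a i))\<^sup>2) \<le> e\<^sup>2" if "m \<ge> K" "finite F" for m F
    proof (rule LIMSEQ_le_const2)
      show "(\<lambda>n. \<Sum>i\<in>F. (cmod (ell2_coord (X m) i - ell2_coord (X n) i))\<^sup>2)
          \<longlonglongrightarrow> (\<Sum>i\<in>F. (cmod (ell2_coord (X m) i - a i))\<^sup>2)"
        by (intro tendsto_intros a)
      have "(\<Sum>i\<in>F. (cmod (ell2_coord (X m) i - ell2_coord (X n) i))\<^sup>2) \<le> e\<^sup>2" if "n \<ge> K" for n
      proof -
        have "(\<Sum>i\<in>F. (cmod (ell2_coord (X m) i - ell2_coord (X n) i))\<^sup>2) \<le> (norm (X m - X n))\<^sup>2"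
          using ell2_finite_sum_le[OF \<open>finite F\<close>, of "X m - X n"] by (simp add: minus_ell2.rep_eq)
        also have "\<dots> \<le> e\<^sup>2"
          using K \<open>m \<ge> K\<close> that by (intro power_mono) (auto intro: less_imp_le)
        finally show ?thesis .
      qed
      then show "\<exists>N. \<forall>n\<ge>N. (\<Sum>i\<in>F. (cmod (ell2_coord (X m) i - ell2_coord (X n) i))\<^sup>2) \<le> e\<^sup>2"
        by blast
    qed
    then show ?thesis
      by blast
  qed
  have summable: "(\<lambda>i. (cmod (ell2_coord (X m) i - a i))\<^sup>2) summable_on UNIV"
    if "\<forall>F. finite F \<longrightarrow> (\<Sum>i\<in>F. (cmod (ell2_coord (X m) i - a i))\<^sup>2) \<le> e\<^sup>2" for m and e :: real
    using that by (intro nonneg_bdd_above_summable_on) (auto intro!: bdd_aboveI[of _ "e\<^sup>2"])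
  obtain K where "\<forall>F. finite F \<longrightarrow> (\<Sum>i\<in>F. (cmod (ell2_coord (X K) i - a i))\<^sup>2) \<le> 1\<^sup>2"
    using tail[of 1] by auto
  from square_summable_add[OF ell2_summable[of "- X K"] summable[OF this]]
  have a_summable: "(\<lambda>i. (cmod (a i))\<^sup>2) summable_on UNIV"
    by (simp add: uminus_ell2.rep_eq)
  define A where "A = Abs_ell2 a"
  have coord_A: "ell2_coord A = a"
    unfolding A_def using a_summable by (simp add: Abs_ell2_inverse)
  have "X \<longlonglongrightarrow> A"
  proof (rule LIMSEQ_I)
    fix e :: real
    assume "0 < e"
    then obtain K where
      K: "\<forall>m\<ge>K. \<forall>F. finite F \<longrightarrow> (\<Sum>i\<in>F. (cmod (ell2_coord (X m) i - a i))\<^sup>2) \<le> (e / 2)\<^sup>2"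
      using tail[of "e / 2"] by auto
    have "norm (X m - A) < e" if "m \<ge> K" for m
    proof -
      have "(norm (X m - A))\<^sup>2 \<le> (e / 2)\<^sup>2"
        unfolding norm_ell2_squared using K that
        by (intro infsum_le_finite_sums ell2_summable) (auto simp: minus_ell2.rep_eq coord_A)
      then have "norm (X m - A) \<le> e / 2"
        by (rule power2_le_imp_le) (use \<open>0 < e\<close> in simp)
      then show ?thesis
        using \<open>0 < e\<close> by simp
    qed
    then show "\<exists>K. \<forall>m\<ge>K. norm (X m - A) < e"
      by blast
  qed
  then show "convergent X"
    by (auto simp: convergent_def)
qed

section \<open>Intertwiners and commutants of 2x2 matrices\<close>

definition hermitian_adjoint :: "complex^'n^'m \<Rightarrow> complex^'m^'n"
  where "hermitian_adjoint A = (\<chi> i j. cnj (A $ j $ i))"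

lemma hermitian_adjoint_mult:
  "hermitian_adjoint (A ** B) = hermitian_adjoint B ** hermitian_adjoint A"
  by (simp add: hermitian_adjoint_def matrix_matrix_mult_def vec_eq_iff mult.commute)

lemma hermitian_adjoint_adjoint [simp]: "hermitian_adjoint (hermitian_adjoint A) = A"
  by (simp add: hermitian_adjoint_def vec_eq_iff)

lemma trace_2: "trace (A :: 'a::semiring_1^2^2) = A $ 1 $ 1 + A $ 2 $ 2"
  by (simp add: trace_def sum_2)

lemma mat_mult_component: "(mat k ** A) $ i $ j = k * A $ i $ j"
  by (simp add: matrix_matrix_mult_def mat_def if_distrib [of "\<lambda>x. x * _"] cong: if_cong)

lemma Cayley_Hamilton_2:
  fixes A :: "'a::comm_ring_1^2^2"
  shows "A ** A = mat (trace A) ** A - mat (det A)"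
  by (simp add: vec_eq_iff forall_2 mat_mult_component trace_2 det_2)
    (simp add: matrix_matrix_mult_def sum_2 mat_def algebra_simps)

lemma det_hermitian_adjoint_2:
  fixes A :: "complex^2^2"
  shows "det (hermitian_adjoint A) = cnj (det A)"
  by (simp add: det_2 hermitian_adjoint_def mult.commute)

text \<open>
  Two 2x2 matrices with equal determinant but different traces have no common eigenvalue
  unless both are singular, hence admit no nonzero intertwiner. In terms of the Cayley-Hamilton
  theorem: expressing \<open>A\<^sup>2\<close> and \<open>B\<^sup>2\<close> in \<open>B\<^sup>2 Q = Q A\<^sup>2\<close> by lower powers leaves
  \<open>(trace A - trace B) Q A = 0\<close>, and \<open>Q A = 0\<close> gives \<open>det A \<cdot> Q = 0\<close> by the same theorem.
\<close>
lemma intertwiner_eq_0: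
  fixes A B Q :: "'a::idom^2^2"
  assumes QA: "B ** Q = Q ** A" and det: "det A = det B" "det A \<noteq> 0"
    and trace: "trace A \<noteq> trace B"
  shows "Q = 0"
proof -
  have right: "Q ** (A ** A) = mat (trace A) ** (Q ** A) - mat (det A) ** Q"
    unfolding Cayley_Hamilton_2
    by (simp add: vec_eq_iff forall_2 mat_mult_component)
      (simp add: matrix_matrix_mult_def sum_2 mat_def algebra_simps)
  have left: "(B ** B) ** Q = mat (trace B) ** (B ** Q) - mat (det B) ** Q"
    unfolding Cayley_Hamilton_2
    by (simp add: vec_eq_iff forall_2 mat_mult_component)
      (simp add: matrix_matrix_mult_def sum_2 mat_def algebra_simps)
  have "(B ** B) ** Q = Q ** (A ** A)"
    by (metis QA matrix_mul_assoc)
  then have "mat (trace B) ** (Q ** A) = mat (trace A) ** (Q ** A)"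
    unfolding left right QA det(1) by simp
  then have "trace B * (Q ** A) $ i $ j = trace A * (Q ** A) $ i $ j" for i j
    by (metis mat_mult_component)
  then have QA_0: "Q ** A = 0"
    using trace by (simp add: vec_eq_iff)
  then have "Q ** (A ** A) = 0"
    unfolding matrix_mul_assoc by (simp add: vec_eq_iff matrix_matrix_mult_def)
  then have "mat (det A) ** Q = 0"
    using right unfolding QA_0 by (simp add: matrix_matrix_mult_def vec_eq_iff)
  then show ?thesis
    using det(2) by (simp add: vec_eq_iff mat_mult_component)
qed

lemma commute_2_iff:
  fixes C D :: "'a::comm_ring_1^2^2"
  shows "C ** D = D ** C \<longleftrightarrow>
    C $ 1 $ 2 * D $ 2 $ 1 = D $ 1 $ 2 * C $ 2 $ 1 \<and>
    (C $ 1 $ 1 - C $ 2 $ 2) * D $ 1 $ 2 = (D $ 1 $ 1 - D $ 2 $ 2) * C $ 1 $ 2 \<and>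
    (C $ 1 $ 1 - C $ 2 $ 2) * D $ 2 $ 1 = (D $ 1 $ 1 - D $ 2 $ 2) * C $ 2 $ 1"
  by (auto simp: vec_eq_iff forall_2 matrix_matrix_mult_def sum_2 algebra_simps)

text \<open>
  The entries of the commutator of two 2x2 matrices are, up to sign, the components of the cross
  product of their vectors \<open>(a\<^sub>1\<^sub>1 - a\<^sub>2\<^sub>2, a\<^sub>1\<^sub>2, a\<^sub>2\<^sub>1)\<close>, so commuting means that these are parallel. If the
  vector of \<open>P\<close> were nonzero, then those of \<open>A\<close> and \<open>B\<close> would be parallel to it and to each other.
\<close>
lemma commutant_scalar:
  fixes A B P :: "'a::field^2^2"
  assumes PA: "P ** A = A ** P" and PB: "P ** B = B ** P" and AB: "A ** B \<noteq> B ** A"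
  shows "P = mat (P $ 1 $ 1)"
proof -
  have parallel: "a2 * b3 = b2 * a3 \<and> a1 * b2 = b1 * a2 \<and> a1 * b3 = b1 * a3"
    if "p1 \<noteq> 0 \<or> p2 \<noteq> 0 \<or> p3 \<noteq> 0"
      "p2 * a3 = a2 * p3" "p1 * a2 = a1 * p2" "p1 * a3 = a1 * p3"
      "p2 * b3 = b2 * p3" "p1 * b2 = b1 * p2" "p1 * b3 = b1 * p3"
    for p1 p2 p3 a1 a2 a3 b1 b2 b3 :: 'a
  proof -
    have "p * (a2 * b3) = p * (b2 * a3) \<and> p * (a1 * b2) = p * (b1 * a2) \<and> p * (a1 * b3) = p * (b1 * a3)"
      if "p = p1 \<or> p = p2 \<or> p = p3" for p
      using that \<open>p2 * a3 = _\<close> \<open>p1 * a2 = _\<close> \<open>p1 * a3 = _\<close> \<open>p2 * b3 = _\<close> \<open>p1 * b2 = _\<close> \<open>p1 * b3 = _\<close>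
      by (elim disjE; intro conjI; algebra)
    then show ?thesis
      using that(1) by (metis mult_left_cancel)
  qed
  have "P $ 1 $ 1 - P $ 2 $ 2 = 0 \<and> P $ 1 $ 2 = 0 \<and> P $ 2 $ 1 = 0"
  proof (rule ccontr)
    assume *: "\<not> (P $ 1 $ 1 - P $ 2 $ 2 = 0 \<and> P $ 1 $ 2 = 0 \<and> P $ 2 $ 1 = 0)"
    have "A ** B = B ** A"
      unfolding commute_2_iff
      by (rule parallel[of "P $ 1 $ 1 - P $ 2 $ 2" "P $ 1 $ 2" "P $ 2 $ 1"])
        (use * PA PB in \<open>unfold commute_2_iff, blast\<close>)+
    with AB show False ..
  qed
  then show ?thesis
    by (simp add: vec_eq_iff forall_2 mat_def)
qed

lemma eigenvalue_2_iff:
  fixes C :: "'a::field^2^2"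
  shows "(\<exists>v. v \<noteq> 0 \<and> C *v v = k *s v) \<longleftrightarrow> k\<^sup>2 - trace C * k + det C = 0"
proof -
  have "C *v v = k *s v \<longleftrightarrow> (C - mat k) *v v = 0" for v
    by (simp add: vec_eq_iff forall_2 matrix_vector_mult_def mat_def sum_2 algebra_simps)
  then have "(\<exists>v. v \<noteq> 0 \<and> C *v v = k *s v) \<longleftrightarrow> \<not> (\<exists>D. D ** (C - mat k) = mat 1)"
    unfolding matrix_left_invertible_ker by blast
  also have "\<dots> \<longleftrightarrow> det (C - mat k) = 0"
    by (metis invertible_det_nz invertible_left_inverse)
  also have "det (C - mat k) = k\<^sup>2 - trace C * k + det C"
    by (simp add: det_2 trace_2 mat_def power2_eq_square algebra_simps)
  finally show ?thesis .
qed

section \<open>The spaces \<open>H(n)\<close> and the singular values of \<open>A\<^sub>n\<close>\<close>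

definition H_vec :: "int \<Rightarrow> complex^2 \<Rightarrow> int ell2 \<times> int ell2"
  where "H_vec n v = (v $ 1 *\<^sub>C ell2_basis n, v $ 2 *\<^sub>C ell2_basis n)"

definition H_coord :: "int \<Rightarrow> int ell2 \<times> int ell2 \<Rightarrow> complex^2"
  where "H_coord n z = vector [ell2_coord (fst z) n, ell2_coord (snd z) n]"

definition cdot :: "complex^'n \<Rightarrow> complex^'n \<Rightarrow> complex"
  where "cdot v w = (\<Sum>i\<in>UNIV. v $ i * cnj (w $ i))"

lemma cdot_commute: "cdot v w = cnj (cdot w v)"
  by (simp add: cdot_def mult.commute)

lemma cdot_matrix_left:
  "cdot (A *v v) w = cdot v (hermitian_adjoint A *v w)"
  unfolding cdot_def matrix_vector_mult_def hermitian_adjoint_def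
  by (simp add: sum_distrib_left sum_distrib_right mult_ac) (rule sum.swap)

lemma cdot_eqI:
  assumes "\<And>w. cdot u w = cdot v w"
  shows "u = v"
proof -
  have "cdot x (axis i 1) = x $ i" for x :: "complex^'a" and i
    by (simp add: cdot_def axis_def if_distrib[of cnj] if_distrib[of "\<lambda>y. _ * y"] cong: if_cong)
  with assms show ?thesis
    by (metis vec_eq_iff)
qed

lemma cinner_ell2_basis: "cinner x (ell2_basis n) = ell2_coord x n"
proof -
  have "(\<Sum>\<^sub>\<infinity>i. ell2_coord x i * cnj (ell2_coord (ell2_basis n) i)) =
      (\<Sum>\<^sub>\<infinity>i\<in>{n}. ell2_coord x i)"
    by (rule infsum_cong_neutral) (auto simp: ell2_basis.rep_eq)
  then show ?thesis
    by (simp add: cinner_ell2.rep_eq)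
qed

lemma H_vec_add: "H_vec n (v + w) = H_vec n v + H_vec n w"
  by (simp add: H_vec_def scaleC_add_left)

lemma H_vec_scale: "H_vec n (a *s v) = a *\<^sub>C H_vec n v"
  by (simp add: H_vec_def scaleC_prod_def scaleC_scaleC)

lemma H_coord_H_vec: "H_coord m (H_vec n v) = (if m = n then v else 0)"
  by (simp add: vec_eq_iff forall_2 H_coord_def H_vec_def scaleC_ell2.rep_eq ell2_basis.rep_eq)

lemma H_vec_inject: "H_vec n v = H_vec n w \<longleftrightarrow> v = w"
  using H_coord_H_vec by metis

lemma H_vec_eq_0_iff: "H_vec n v = 0 \<longleftrightarrow> v = 0"
  using H_vec_inject[of n v 0] H_vec_scale[of n 0 v]
  by (simp add: H_vec_def zero_prod_def)

lemma H_coord_add: "H_coord n (x + y) = H_coord n x + H_coord n y"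
  by (simp add: vec_eq_iff forall_2 H_coord_def plus_ell2.rep_eq)

lemma H_coord_scale: "H_coord n (a *\<^sub>C x) = a *s H_coord n x"
  by (simp add: vec_eq_iff forall_2 H_coord_def scaleC_prod_def scaleC_ell2.rep_eq)

lemma H_coord_eqI:
  assumes "\<And>n. H_coord n x = H_coord n y"
  shows "x = y"
proof -
  have "ell2_coord (fst x) n = ell2_coord (fst y) n \<and> ell2_coord (snd x) n = ell2_coord (snd y) n" for n
    using assms[of n] by (simp add: H_coord_def vec_eq_iff forall_2)
  then show ?thesis
    by (simp add: prod_eq_iff ell2_coord_inject[symmetric] fun_eq_iff)
qed

lemma cinner_H_vec: "cinner z (H_vec n v) = cdot (H_coord n z) v"
  by (simp add: cinner_prod_def H_vec_def cinner_scaleC_right cinner_ell2_basis cdot_def H_coord_def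
      sum_2 mult.commute)

lemma H_space_eq: "H_space n = range (H_vec n)"
proof
  have "csubspace (range (H_vec n))"
    unfolding complex_vector.subspace_def
    using H_vec_eq_0_iff[of n 0] H_vec_add[symmetric] H_vec_scale[symmetric] by (force simp: image_iff)
  moreover have "(ell2_basis n, 0) = H_vec n (vector [1, 0])" "(0, ell2_basis n) = H_vec n (vector [0, 1])"
    by (simp_all add: H_vec_def)
  ultimately show "H_space n \<subseteq> range (H_vec n)"
    unfolding H_space_def H_basis_def by (intro complex_vector.span_minimal) auto
  have "v $ 1 *\<^sub>C (ell2_basis n, 0) + v $ 2 *\<^sub>C (0, ell2_basis n) \<in> H_space n" for v :: "complex^2"
    unfolding H_space_def H_basis_def
    by (intro complex_vector.span_add complex_vector.span_scale complex_vector.span_base) simp_all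
  then have "H_vec n v \<in> H_space n" for v
    by (simp add: H_vec_def scaleC_prod_def)
  then show "range (H_vec n) \<subseteq> H_space n"
    by blast
qed

lemma orthogonal_to_H_vec_eq_0:
  assumes "\<And>n v. cinner x (H_vec n v) = 0"
  shows "x = 0"
proof (rule H_coord_eqI)
  fix n
  have "cdot (H_coord n x) v = cdot 0 v" for v
    using assms[of n v] by (simp add: cinner_H_vec) (simp add: cdot_def)
  then have "H_coord n x = 0"
    by (rule cdot_eqI)
  then show "H_coord n x = H_coord n 0"
    using H_coord_scale[of n 0 0] by simp
qed

lemma closed_csubspace_containing_H_vec:
  assumes "csubspace M" "closed M" "\<And>n v. H_vec n v \<in> M"
  shows "M = UNIV"
proof (rule closed_csubspace_eq_UNIV[OF assms(1,2)])
  have "y = 0" if "y \<in> orthogonal_complement M" for y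
    using that assms(3) cinner_commute[of y]
    by (intro orthogonal_to_H_vec_eq_0) (simp add: orthogonal_complement_def)
  then show "orthogonal_complement M \<subseteq> {0}"
    by blast
qed

text \<open>
  \<open>H_vec m\<close> and \<open>H_vec n\<close> are unitary, so the adjoint of a map between \<open>H(m)\<close> and \<open>H(n)\<close> is given by the
  conjugate transpose of its matrix.
\<close>
lemma adjoint_on_H_space:
  assumes F: "\<And>v. F (H_vec m v) = H_vec n (A *v v)"
  shows "adjoint_on (H_space m) (H_space n) F (H_vec n w) = H_vec m (hermitian_adjoint A *v w)"
proof -
  have char: "(\<forall>v\<in>H_space m. cinner (F v) (H_vec n w) = cinner v (H_vec m u)) \<longleftrightarrow>
      u = hermitian_adjoint A *v w" for u
  proof -
    have "(\<forall>v\<in>H_space m. cinner (F v) (H_vec n w) = cinner v (H_vec m u)) \<longleftrightarrow>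
        (\<forall>v. cdot v (hermitian_adjoint A *v w) = cdot v u)"
      by (simp add: H_space_eq F cinner_H_vec H_coord_H_vec cdot_matrix_left)
    also have "\<dots> \<longleftrightarrow> u = hermitian_adjoint A *v w"
      by (metis cdot_commute cdot_eqI)
    finally show ?thesis .
  qed
  have "(THE u. u \<in> H_space m \<and> (\<forall>v\<in>H_space m. cinner (F v) (H_vec n w) = cinner v u)) =
      H_vec m (hermitian_adjoint A *v w)"
  proof (rule the_equality)
    show "H_vec m (hermitian_adjoint A *v w) \<in> H_space m \<and> (\<forall>v\<in>H_space m.
        cinner (F v) (H_vec n w) = cinner v (H_vec m (hermitian_adjoint A *v w)))"
      using char by (simp add: H_space_eq)
  next
    fix u
    assume u: "u \<in> H_space m \<and> (\<forall>v\<in>H_space m. cinner (F v) (H_vec n w) = cinner v u)"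
    then obtain u' where "u = H_vec m u'"
      by (auto simp: H_space_eq)
    then show "u = H_vec m (hermitian_adjoint A *v w)"
      using u char[of u'] by simp
  qed
  then show ?thesis
    by (simp add: adjoint_on_def H_space_eq)
qed

lemma A_op_H_vec:
  assumes "\<And>v. T (H_vec n v) = H_vec (n + 1) (W *v v)"
  shows "A_op T n (H_vec n v) = H_vec n ((hermitian_adjoint W ** W) *v v)"
proof -
  have "T_restr T n (H_vec n v) = H_vec (n + 1) (W *v v)" for v
    using assms by (simp add: T_restr_def H_space_eq)
  then show ?thesis
    using adjoint_on_H_space[of "T_restr T n" n "n + 1" W]
    by (simp add: A_op_def compose_def H_space_eq matrix_vector_mul_assoc)
qed

lemma singular_values_H_space:
  assumes F: "\<And>v. F (H_vec n v) = H_vec n (A *v v)"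
  shows "singular_values (H_space n) F =
    {s. 0 \<le> s \<and> (\<exists>v. v \<noteq> 0 \<and> (hermitian_adjoint A ** A) *v v = complex_of_real (s\<^sup>2) *s v)}"
proof -
  have "adjoint_on (range (H_vec n)) (range (H_vec n)) F (F (H_vec n v)) =
      H_vec n ((hermitian_adjoint A ** A) *v v)" for v
    using adjoint_on_H_space[of F n n A] F by (simp add: H_space_eq matrix_vector_mul_assoc)
  then show ?thesis
    unfolding singular_values_def
    by (simp add: H_space_eq H_vec_eq_0_iff H_vec_scale[symmetric] H_vec_inject del: of_real_power)
qed

text \<open>
  The singular values of \<open>A\<^sub>n\<close> are the square roots of the eigenvalues of \<open>A\<^sub>n\<^sup>2\<close>, whose characteristic
  polynomial is a function of the trace and determinant of \<open>A\<^sub>n\<close>. Thus, when all determinants agree,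
  distinct sets of singular values entail distinct traces.
\<close>
lemma singular_values_A_op:
  assumes "\<And>v. T (H_vec n v) = H_vec (n + 1) (W *v v)"
  defines "B \<equiv> hermitian_adjoint W ** W"
  shows "singular_values (H_space n) (A_op T n) =
    {s. 0 \<le> s \<and> (complex_of_real (s\<^sup>2))\<^sup>2 - ((trace B)\<^sup>2 - 2 * det B) * complex_of_real (s\<^sup>2) + (det B)\<^sup>2 = 0}"
proof -
  have B: "hermitian_adjoint B = B"
    by (simp add: B_def hermitian_adjoint_mult)
  have "trace (B ** B) = (trace B)\<^sup>2 - 2 * det B"
    by (simp add: trace_2 det_2 matrix_matrix_mult_def sum_2 power2_eq_square algebra_simps)
  moreover have "det (B ** B) = (det B)\<^sup>2"
    by (simp add: det_mul power2_eq_square)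
  ultimately show ?thesis
    unfolding singular_values_H_space[of "A_op T n" n B, OF A_op_H_vec[of T n W, OF assms(1), folded B_def]]
      B eigenvalue_2_iff by simp
qed

text \<open>
  Both sides are continuous and linear in \<open>z\<close>, so it suffices to compare them on the spaces \<open>H(n)\<close>.
\<close>
lemma H_coord_block_shift:
  assumes T: "bounded_clinear T" and W: "\<And>n v. T (H_vec n v) = H_vec (n + 1) (W n *v v)"
  shows "H_coord (n + 1) (T z) = W n *v H_coord n z"
proof -
  let ?adj = "\<lambda>w. H_vec n (hermitian_adjoint (W n) *v w)"
  define K where "K = {z. \<forall>w. cinner (T z) (H_vec (n + 1) w) = cinner z (?adj w)}"
  have lin: "bounded_linear T" "T (a *\<^sub>C x) = a *\<^sub>C T x" for a x
    using T unfolding bounded_clinear_def by blast+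
  have add: "T (x + y) = T x + T y" "T 0 = 0" for x y
    using lin(1) by (simp_all add: linear_simps)
  have "K = UNIV"
  proof (rule closed_csubspace_containing_H_vec)
    show "csubspace K"
      unfolding complex_vector.subspace_def
      by (auto simp: K_def add lin cinner_add_left cinner_scaleC_left)
    show "closed K"
      unfolding K_def
      by (intro closed_Collect_all closed_Collect_eq continuous_on_cinner_left
          linear_continuous_on lin(1) continuous_on_id)
    show "H_vec m v \<in> K" for m v
      by (simp add: K_def W cinner_H_vec H_coord_H_vec cdot_matrix_left) (simp add: cdot_def)
  qed
  then have "cdot (H_coord (n + 1) (T z)) w = cdot (W n *v H_coord n z) w" for w
    by (auto simp: K_def cinner_H_vec cdot_matrix_left)
  then show ?thesis
    by (rule cdot_eqI)
qed

section \<open>Irreducible shifts with 2x2 matrix weights\<close>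

text \<open>
  The reasoning takes place in the blocks \<open>Q\<close> of the projection onto a reducing subspace. The relation
  \<open>P T = T P\<close> links each block to its diagonal neighbour, and together with its adjoint it shows that
  the blocks intertwine the matrices \<open>W\<^sup>* W\<close> and also the matrices \<open>W W\<^sup>*\<close>. Because a block
  determines all blocks on its diagonal, it is enough to have distinct traces at large indices and
  noncommuting matrices at a single place.
\<close>
theorem irreducible_block_shift:
  fixes W :: "int \<Rightarrow> complex^2^2"
  assumes T: "bounded_clinear T" and W: "\<And>n v. T (H_vec n v) = H_vec (n + 1) (W n *v v)"
    and det: "\<And>n. det (W n) = 1"
    and traces: "\<And>m n. m > N \<Longrightarrow> n > N \<Longrightarrow> m \<noteq> n \<Longrightarrow>
      trace (hermitian_adjoint (W m) ** W m) \<noteq> trace (hermitian_adjoint (W n) ** W n)"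
    and noncommuting: "(hermitian_adjoint (W (k + 1)) ** W (k + 1)) ** (W k ** hermitian_adjoint (W k)) \<noteq>
      (W k ** hermitian_adjoint (W k)) ** (hermitian_adjoint (W (k + 1)) ** W (k + 1))"
  shows "irreducible_operator T"
  unfolding irreducible_operator_def
proof (intro allI impI)
  fix M
  assume red: "reducing_subspace T M"
  then have M: "csubspace M" "closed M"
    by (auto simp: reducing_subspace_def)
  let ?P = "orthogonal_projection M"
  let ?A = "\<lambda>n. hermitian_adjoint (W n) ** W n"
  have T_add: "T (x + y) = T x + T y" for x y
    using T unfolding bounded_clinear_def by (simp add: linear_simps)
  have PT: "?P (T x) = T (?P x)" for x
    by (rule orthogonal_projection_commute[OF M red T_add])
  define Q where "Q m n = matrix (\<lambda>v. H_coord m (?P (H_vec n v)))" for m n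
  have Q: "Q m n *v v = H_coord m (?P (H_vec n v))" for m n v
  proof -
    have "Vector_Spaces.linear (*s) (*s) (\<lambda>v. H_coord m (?P (H_vec n v)))"
      by unfold_locales
        (simp_all add: H_vec_add H_vec_scale orthogonal_projection_add[OF M]
          orthogonal_projection_scaleC[OF M] H_coord_add H_coord_scale)
    then show ?thesis
      unfolding Q_def by (rule matrix_works)
  qed
  have Q_shift: "Q (m + 1) (n + 1) ** W n = W m ** Q m n" for m n
    by (simp add: matrix_eq matrix_vector_mul_assoc[symmetric] Q W[symmetric] PT
        H_coord_block_shift[OF T W])
  have Q_adjoint: "hermitian_adjoint (Q m n) = Q n m" for m n
  proof -
    have "cdot v (hermitian_adjoint (Q m n) *v w) = cdot v (Q n m *v w)" for v w
    proof -
      have "cdot v (hermitian_adjoint (Q m n) *v w) = cinner (?P (H_vec n v)) (H_vec m w)"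
        by (simp add: cdot_matrix_left[symmetric] Q cinner_H_vec)
      also have "\<dots> = cnj (cinner (?P (H_vec m w)) (H_vec n v))"
        using orthogonal_projection_selfadjoint[OF M] cinner_commute by metis
      also have "\<dots> = cdot v (Q n m *v w)"
        by (simp add: cinner_H_vec Q cdot_commute[of v])
      finally show ?thesis .
    qed
    then show ?thesis
      unfolding matrix_eq by (metis cdot_commute cdot_eqI)
  qed
  have Q_shift_adjoint: "hermitian_adjoint (W m) ** Q (m + 1) (n + 1) = Q m n ** hermitian_adjoint (W n)"
    for m n
    using arg_cong[OF Q_shift[of n m], of hermitian_adjoint]
    by (simp add: hermitian_adjoint_mult Q_adjoint)
  have A_Q: "?A m ** Q m n = Q m n ** ?A n" for m n
    by (metis Q_shift Q_shift_adjoint matrix_mul_assoc)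
  have B_Q: "(W m ** hermitian_adjoint (W m)) ** Q (m + 1) (n + 1) =
      Q (m + 1) (n + 1) ** (W n ** hermitian_adjoint (W n))" for m n
    by (metis Q_shift Q_shift_adjoint matrix_mul_assoc)
  have "\<exists>V. W n ** V = mat 1 \<and> V ** W n = mat 1" for n
    using det[of n] invertible_det_nz[of "W n"] by (simp add: invertible_def)
  then obtain V where V: "\<And>n. W n ** V n = mat 1" "\<And>n. V n ** W n = mat 1"
    by metis
  have Q_forward: "Q (m + 1) (n + 1) = W m ** Q m n ** V n" for m n
    by (metis Q_shift V(1) matrix_mul_assoc matrix_mul_rid)
  have Q_backward: "Q m n = V m ** Q (m + 1) (n + 1) ** W n" for m n
    by (metis Q_shift V(2) matrix_mul_assoc matrix_mul_lid)

  have Q_0: "Q m n = 0" if "m \<noteq> n" for m n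
  proof -
    have "Q m n = 0" if "Q (m + int j) (n + int j) = 0" for j
      using that
    proof (induction j arbitrary: m n)
      case (Suc j)
      have "m + 1 + int j = m + int (Suc j)" "n + 1 + int j = n + int (Suc j)"
        by simp_all
      then have "Q (m + 1) (n + 1) = 0"
        using Suc.IH[of "m + 1" "n + 1"] Suc.prems by argo
      then have "Q m n = V m ** 0 ** W n"
        using Q_backward[of m n] by argo
      then show ?case
        by (simp add: matrix_matrix_mult_def zero_vec_def)
    qed simp
    \<comment> \<open>far enough along the diagonal for both indices to exceed \<open>N\<close>\<close>
    moreover define j where "j = nat (max (N - m) (N - n) + 1)"
    have "Q (m + int j) (n + int j) = 0"
    proof (rule intertwiner_eq_0[OF A_Q])
      show "det (?A (n + int j)) = det (?A (m + int j))" "det (?A (n + int j)) \<noteq> 0"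
        by (simp_all add: det_mul det det_hermitian_adjoint_2)
      show "trace (?A (n + int j)) \<noteq> trace (?A (m + int j))"
        by (rule traces) (use that in \<open>auto simp: j_def\<close>)
    qed
    ultimately show ?thesis .
  qed

  \<comment> \<open>At the index \<open>k + 1\<close> both \<open>W\<^sup>* W\<close> of the outgoing and \<open>W W\<^sup>*\<close> of the incoming weight act.\<close>
  define q where "q = Q (k + 1) (k + 1) $ 1 $ 1"
  have "Q (k + 1) (k + 1) = mat q"
    unfolding q_def
    by (rule commutant_scalar[OF A_Q[symmetric] B_Q[symmetric] noncommuting])
  have mat_commute: "mat q ** C = C ** mat q" for C :: "complex^2^2"
    by (simp add: vec_eq_iff forall_2 matrix_matrix_mult_def mat_def sum_2 mult.commute)
  have Q_diag: "Q n n = mat q" for n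
  proof (induction n rule: int_induct[where k = "k + 1"])
    case (step1 n)
    then show ?case
      using Q_forward[of n n] V(1) by (metis mat_commute matrix_mul_assoc matrix_mul_rid)
  next
    case (step2 n)
    then show ?case
      using Q_backward[of "n - 1" "n - 1"] V(2)
      by (metis diff_add_cancel mat_commute matrix_mul_assoc matrix_mul_rid)
  qed fact
  have P_H_vec: "?P (H_vec n v) = q *\<^sub>C H_vec n v" for n v
  proof (rule H_coord_eqI)
    fix m
    have "mat q *v v = q *s v"
      by (simp add: vec_eq_iff forall_2 matrix_vector_mult_def mat_def sum_2)
    then show "H_coord m (?P (H_vec n v)) = H_coord m (q *\<^sub>C H_vec n v)"
      by (simp add: Q[symmetric] Q_0 Q_diag H_coord_scale H_coord_H_vec)
  qed
  have "?P (?P (H_vec 0 (axis 1 1))) = ?P (H_vec 0 (axis 1 1))"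
    by (intro orthogonal_projection_idem[OF M] orthogonal_projection_mem[OF M])
  then have "(q * q) *s axis 1 1 = q *s (axis 1 1 :: complex^2)"
    by (simp add: P_H_vec orthogonal_projection_scaleC[OF M] scaleC_scaleC H_vec_scale[symmetric]
        H_vec_inject)
  then have "q = 0 \<or> q = 1"
    by (auto simp: vec_eq_iff forall_2 axis_def)
  then show "M = {0} \<or> M = UNIV"
  proof
    assume q: "q = 0"
    have "x = 0" if "x \<in> M" for x
    proof (rule orthogonal_to_H_vec_eq_0)
      fix n v
      have "cinner x (H_vec n v) = cinner x (?P (H_vec n v))"
        using orthogonal_projection_selfadjoint[OF M] orthogonal_projection_idem[OF M that] by metis
      then show "cinner x (H_vec n v) = 0"
        by (simp add: P_H_vec q)
    qed
    then show ?thesis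
      using complex_vector.subspace_0[OF M(1)] by blast
  next
    assume "q = 1"
    then have "H_vec n v \<in> M" for n v
      using orthogonal_projection_mem[OF M, of "H_vec n v"] by (simp add: P_H_vec)
    then show ?thesis
      using closed_csubspace_containing_H_vec[OF M] by blast
  qed
qed

section \<open>The operator \<open>T(t\<^sub>n, d\<^sub>n)\<close>\<close>

lemma bounded_clinear_block_operator:
  assumes "bounded_clinear T0" "bounded_clinear T1" "bounded_clinear X"
  shows "bounded_clinear (block_operator T0 T1 X)"
proof -
  have lin: "bounded_linear T0" "bounded_linear T1" "bounded_linear X"
    using assms unfolding bounded_clinear_def by blast+
  have "bounded_linear (\<lambda>z. (T0 (fst z) + (X (T1 (snd z)) - T0 (X (snd z))), T1 (snd z)))"
    by (intro bounded_linear_Pair bounded_linear_add bounded_linear_sub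
        bounded_linear_compose[OF lin(1)] bounded_linear_compose[OF lin(2)]
        bounded_linear_compose[OF lin(3)] bounded_linear_fst bounded_linear_snd)
  moreover have "T0 (a *\<^sub>C x) = a *\<^sub>C T0 x" "T1 (a *\<^sub>C x) = a *\<^sub>C T1 x" "X (a *\<^sub>C x) = a *\<^sub>C X x" for a x
    using assms unfolding bounded_clinear_def by blast+
  ultimately show ?thesis
    unfolding bounded_clinear_def
    by (simp add: block_operator_def case_prod_unfold scaleC_prod_def scaleC_add_right
        complex_vector.scale_right_diff_distrib)
qed

definition block_weight :: "complex \<Rightarrow> complex \<Rightarrow> complex^2^2"
  where "block_weight t c = vector [vector [t, c], vector [0, 1 / t]]"

lemma block_operator_H_vec:
  assumes T0: "is_weighted_shift t T0" and T1: "is_weighted_shift (\<lambda>n. 1 / t n) T1"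
    and X: "is_diagonal d X"
  shows "block_operator T0 T1 X (H_vec n v) =
    H_vec (n + 1) (block_weight (t n) (d (n + 1) / t n - d n * t n) *v v)"
proof -
  have scale: "T0 (a *\<^sub>C x) = a *\<^sub>C T0 x" "T1 (a *\<^sub>C x) = a *\<^sub>C T1 x" "X (a *\<^sub>C x) = a *\<^sub>C X x" for a x
    using assms unfolding is_weighted_shift_def is_diagonal_def bounded_clinear_def by blast+
  have basis: "T0 (ell2_basis n) = t n *\<^sub>C ell2_basis (n + 1)"
    "T1 (ell2_basis n) = (1 / t n) *\<^sub>C ell2_basis (n + 1)" "X (ell2_basis n) = d n *\<^sub>C ell2_basis n" for n
    using assms unfolding is_weighted_shift_def is_diagonal_def by blast+
  show ?thesis
    unfolding block_operator_def H_vec_def block_weight_def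
    by (simp add: scale basis scaleC_scaleC matrix_vector_mult_def sum_2 mult_ac
        complex_vector.scale_left_distrib[symmetric] complex_vector.scale_left_diff_distrib[symmetric])
      (simp add: algebra_simps)
qed

text \<open>
  Each condition keeps one entry away from 0 in the commutator of \<open>T\<^sub>n\<^sup>*T\<^sub>n\<close> and
  \<open>T\<^sub>n\<^sub>-\<^sub>1T\<^sub>n\<^sub>-\<^sub>1\<^sup>*\<close>: equality of the diagonal entries of the two products says that the product of
  opposite off-diagonal entries is real, contrary to the first condition, and equality of the lower
  left entries contradicts the second one.
\<close>
lemma block_weight_commute:
  assumes "t \<noteq> 0" "t' \<noteq> 0"
    and "(hermitian_adjoint (block_weight t c) ** block_weight t c) **
        (block_weight t' c' ** hermitian_adjoint (block_weight t' c')) =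
      (block_weight t' c' ** hermitian_adjoint (block_weight t' c')) **
        (hermitian_adjoint (block_weight t c) ** block_weight t c)"
  shows "cnj t / t' * c * cnj c' \<in> \<real>"
    and "t * cnj c * complex_of_real ((cmod t')\<^sup>2 - 1 / (cmod t')\<^sup>2 + (cmod c')\<^sup>2) =
      1 / t' * cnj c' * complex_of_real ((cmod t)\<^sup>2 - 1 / (cmod t)\<^sup>2 - (cmod c)\<^sup>2)"
proof -
  note entries = block_weight_def hermitian_adjoint_def matrix_matrix_mult_def sum_2
  have norms: "complex_of_real ((cmod z)\<^sup>2) = z * cnj z"
    "complex_of_real (1 / (cmod z)\<^sup>2) = 1 / (z * cnj z)" for z
    using complex_norm_square[of z] by simp_all
  have 1: "cnj t * c * (1 / t' * cnj c') = c' * (1 / cnj t') * (cnj c * t)"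
    and 2: "(cnj t * t - (cnj c * c + 1 / cnj t * (1 / t))) * (1 / t' * cnj c') =
      (t' * cnj t' + c' * cnj c' - 1 / t' * (1 / cnj t')) * (cnj c * t)"
    using assms(3)[unfolded commute_2_iff] by (simp_all add: entries mult.commute)
  show "cnj t / t' * c * cnj c' \<in> \<real>"
    using 1 by (simp add: Reals_cnj_iff mult_ac)
  show "t * cnj c * complex_of_real ((cmod t')\<^sup>2 - 1 / (cmod t')\<^sup>2 + (cmod c')\<^sup>2) =
      1 / t' * cnj c' * complex_of_real ((cmod t)\<^sup>2 - 1 / (cmod t)\<^sup>2 - (cmod c)\<^sup>2)"
    unfolding of_real_add of_real_diff norms using 2 by (simp add: algebra_simps)
qed

theorem theorem3p4:
  fixes t d c :: "int \<Rightarrow> complex"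
    and T0 T1 X :: "int ell2 \<Rightarrow> int ell2"
    and T :: "int ell2 \<times> int ell2 \<Rightarrow> int ell2 \<times> int ell2"
    and g :: "int \<Rightarrow> int" and N :: int
  assumes t_nonzero: "\<forall>n. t n \<noteq> 0"
    and T0: "is_weighted_shift t T0"
    and T1: "is_weighted_shift (\<lambda>n. 1 / t n) T1"
    and d_bounded: "bounded (range d)"
    and X: "is_diagonal d X"
    and not_intertwining: "X \<circ> T1 \<noteq> T0 \<circ> X"
    and T: "T = block_operator T0 T1 X"
    and c: "\<forall>n. c n = d (n + 1) / t n - d n * t n"
    and g_bij: "bij g"
    and distinct: "\<forall>m>N. \<forall>n>N. m \<noteq> n \<longrightarrow>
      singular_values (H_space m) (A_op T m) \<noteq> singular_values (H_space n) (A_op T n)"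
    and traces: "\<forall>n. trace_wrt (H_basis n) (A_op T n) = trace_wrt (H_basis (g n)) (A_op T (g n))"
    and conditions:
      "(\<forall>n. cnj (t n) / t (n - 1) * c n * cnj (c (n - 1)) \<notin> \<real>) \<or>
       (\<forall>n. t n * cnj (c n) *
              complex_of_real ((cmod (t (n - 1)))\<^sup>2 - 1 / (cmod (t (n - 1)))\<^sup>2 + (cmod (c (n - 1)))\<^sup>2)
          \<noteq> 1 / t (n - 1) * cnj (c (n - 1)) *
              complex_of_real ((cmod (t n))\<^sup>2 - 1 / (cmod (t n))\<^sup>2 - (cmod (c n))\<^sup>2))"
  shows "irreducible_operator T"
proof -
  define W where "W n = block_weight (t n) (c n)" for n
  have T_H_vec: "T (H_vec n v) = H_vec (n + 1) (W n *v v)" for n v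
    using block_operator_H_vec[OF T0 T1 X] by (simp add: T W_def c)
  have det: "det (W n) = 1" for n
    using t_nonzero by (simp add: W_def block_weight_def det_2)
  show ?thesis
  proof (rule irreducible_block_shift[where N = N and k = 0])
    show "bounded_clinear T"
      unfolding T using T0 T1 X
      by (intro bounded_clinear_block_operator) (simp_all add: is_weighted_shift_def is_diagonal_def)
    show "T (H_vec n v) = H_vec (n + 1) (W n *v v)" for n v
      by (rule T_H_vec)
    show "det (W n) = 1" for n
      by (rule det)
  next
    fix m n
    assume "m > N" "n > N" "m \<noteq> n"
    with distinct have "singular_values (H_space m) (A_op T m) \<noteq> singular_values (H_space n) (A_op T n)"
      by blast
    then show "trace (hermitian_adjoint (W m) ** W m) \<noteq> trace (hermitian_adjoint (W n) ** W n)"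
      unfolding singular_values_A_op[of T, OF T_H_vec]
      by (auto simp: det_mul det_hermitian_adjoint_2 det)
  next
    have "t 0 \<noteq> 0" "t 1 \<noteq> 0"
      using t_nonzero by blast+
    note commute = block_weight_commute[OF this(2,1), of "c 1" "c 0"]
    from conditions show "(hermitian_adjoint (W (0 + 1)) ** W (0 + 1)) ** (W 0 ** hermitian_adjoint (W 0)) \<noteq>
      (W 0 ** hermitian_adjoint (W 0)) ** (hermitian_adjoint (W (0 + 1)) ** W (0 + 1))"
    proof
      assume "\<forall>n. cnj (t n) / t (n - 1) * c n * cnj (c (n - 1)) \<notin> \<real>"
      from spec[OF this, of 1] show ?thesis
        using commute(1) by (auto simp: W_def)
    next
      assume "\<forall>n. t n * cnj (c n) *
              complex_of_real ((cmod (t (n - 1)))\<^sup>2 - 1 / (cmod (t (n - 1)))\<^sup>2 + (cmod (c (n - 1)))\<^sup>2)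
          \<noteq> 1 / t (n - 1) * cnj (c (n - 1)) *
              complex_of_real ((cmod (t n))\<^sup>2 - 1 / (cmod (t n))\<^sup>2 - (cmod (c n))\<^sup>2)"
      from spec[OF this, of 1] show ?thesis
        using commute(2) by (auto simp: W_def)
    qed
  qed
qed

end
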